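(* Let $q_1,q_2,q_3,q_4$ be four quaternions and let $$\mathcal{CR}(q_1,q_2,q_3,q_4):=(q_1-q_3)(q_1-q_4)^{-1}(q_2-q_4)(q_2-q_3)^{-1}$$ be their cross-ratio. If $\mathcal{CR}(q_1,q_2,q_3,q_4)$ is real, then it is invariant under the action of all quaternionic fractional linear transformations, i.e. $\mathcal{CR}(L(q_1),L(q_2),L(q_3),L(q_4))=\mathcal{CR}(q_1,q_2,q_3,q_4)$ for every quaternionic fractional linear transformation $L$.
   Context: $\mathbb{H}$ is the skew field of real quaternions. A quaternionic fractional linear transformation is a map of $\mathbb{H}\cup\{\infty\}$ of the form $L(q)=(aq+b)(cq+d)^{-1}$ with $a,b,c,d\in\mathbb{H}$ and $\begin{bmatrix} a & b\\ c & d\end{bmatrix}$ an invertible matrix (equivalently $|a|^2|d|^2+|c|^2|b|^2-2\,\mathrm{Re}(c\overline{a}b\overline{d})\neq 0$). The cross-ratio is considered for pairwise distinct points of $\mathbb{H}\cup\{\infty\}$; if one of the four points is $\infty$, the cross-ratio is understood as the limit obtained by replacing that point with a real number $x$ and letting $x\to+\infty$. *)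

theory Defs
  imports "HOL-Analysis.Analysis"
begin

section \<open>The normed division algebra of real quaternions\<close>

codatatype quat = Quat (QRe: real) (QI: real) (QJ: real) (QK: real)

lemma quat_eq_iff: "x = y \<longleftrightarrow> QRe x = QRe y \<and> QI x = QI y \<and> QJ x = QJ y \<and> QK x = QK y"
  by (auto intro: quat.expand)

instantiation quat :: ab_group_add
begin

primcorec zero_quat where
  "QRe 0 = 0"
| "QI 0 = 0"
| "QJ 0 = 0"
| "QK 0 = 0"

primcorec plus_quat where
  "QRe (x + y) = QRe x + QRe y"
| "QI (x + y) = QI x + QI y"
| "QJ (x + y) = QJ x + QJ y"
| "QK (x + y) = QK x + QK y"

primcorec uminus_quat where
  "QRe (- x) = - QRe x"
| "QI (- x) = - QI x"
| "QJ (- x) = - QJ x"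
| "QK (- x) = - QK x"

primcorec minus_quat where
  "QRe (x - y) = QRe x - QRe y"
| "QI (x - y) = QI x - QI y"
| "QJ (x - y) = QJ x - QJ y"
| "QK (x - y) = QK x - QK y"

instance
  by standard (simp_all add: quat_eq_iff)

end

text \<open>Multiplication is determined by $i^2 = j^2 = k^2 = ijk = -1$.\<close>

instantiation quat :: ring_1
begin

primcorec one_quat where
  "QRe 1 = 1"
| "QI 1 = 0"
| "QJ 1 = 0"
| "QK 1 = 0"

primcorec times_quat where
  "QRe (x * y) = QRe x * QRe y - QI x * QI y - QJ x * QJ y - QK x * QK y"
| "QI (x * y) = QRe x * QI y + QI x * QRe y + QJ x * QK y - QK x * QJ y"
| "QJ (x * y) = QRe x * QJ y - QI x * QK y + QJ x * QRe y + QK x * QI y"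
| "QK (x * y) = QRe x * QK y + QI x * QJ y - QJ x * QI y + QK x * QRe y"

instance
  by standard (simp_all add: quat_eq_iff algebra_simps)

end

instantiation quat :: real_algebra_1
begin

primcorec scaleR_quat where
  "QRe (scaleR r x) = r * QRe x"
| "QI (scaleR r x) = r * QI x"
| "QJ (scaleR r x) = r * QJ x"
| "QK (scaleR r x) = r * QK x"

instance
  by standard (simp_all add: quat_eq_iff algebra_simps)

end

instantiation quat :: real_inner
begin

definition inner_quat :: "quat \<Rightarrow> quat \<Rightarrow> real" where
  "inner_quat x y = QRe x * QRe y + QI x * QI y + QJ x * QJ y + QK x * QK y"

definition norm_quat :: "quat \<Rightarrow> real" where
  "norm_quat x = sqrt (inner x x)"

definition sgn_quat :: "quat \<Rightarrow> quat" where
  "sgn_quat x = x /\<^sub>R norm x"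

definition dist_quat :: "quat \<Rightarrow> quat \<Rightarrow> real" where
  "dist_quat x y = norm (x - y)"

definition uniformity_quat :: "(quat \<times> quat) filter" where
  "uniformity_quat = (INF e\<in>{0 <..}. principal {(x, y). dist x y < e})"

definition open_quat :: "quat set \<Rightarrow> bool" where
  "open_quat U \<longleftrightarrow> (\<forall>x\<in>U. eventually (\<lambda>(x', y). x' = x \<longrightarrow> y \<in> U) uniformity)"

instance
proof
  fix x y z :: quat and r :: real and U :: "quat set"
  show "inner x y = inner y x" "inner (x + y) z = inner x z + inner y z"
    "inner (scaleR r x) y = r * inner x y" "0 \<le> inner x x"
    by (simp_all add: inner_quat_def algebra_simps)
  show "inner x x = 0 \<longleftrightarrow> x = 0"
    by (simp add: inner_quat_def quat_eq_iff add_nonneg_eq_0_iff)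
qed (simp_all add: norm_quat_def sgn_quat_def dist_quat_def uniformity_quat_def open_quat_def)

end

text \<open>The inverse of $x$ is its conjugate divided by $|x|^2$.\<close>

instantiation quat :: real_normed_div_algebra
begin

primcorec inverse_quat where
  "QRe (inverse x) = QRe x / (norm x)\<^sup>2"
| "QI (inverse x) = - QI x / (norm x)\<^sup>2"
| "QJ (inverse x) = - QJ x / (norm x)\<^sup>2"
| "QK (inverse x) = - QK x / (norm x)\<^sup>2"

definition divide_quat :: "quat \<Rightarrow> quat \<Rightarrow> quat" where
  "divide_quat x y = x * inverse y"

instance
proof
  fix x y :: quat
  have norm_sq: "(norm q)\<^sup>2 = QRe q * QRe q + QI q * QI q + QJ q * QJ q + QK q * QK q" for q :: quat
    by (simp add: norm_quat_def inner_quat_def)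
  have inv: "inverse q * q = 1 \<and> q * inverse q = 1" if "q \<noteq> 0" for q :: quat
  proof -
    have "(norm q)\<^sup>2 \<noteq> 0"
      using that by simp
    moreover have "QRe q * QRe q / (norm q)\<^sup>2 + QI q * QI q / (norm q)\<^sup>2 +
        QJ q * QJ q / (norm q)\<^sup>2 + QK q * QK q / (norm q)\<^sup>2 = (norm q)\<^sup>2 / (norm q)\<^sup>2"
      by (simp only: norm_sq add_divide_distrib [symmetric])
    ultimately show ?thesis
      by (simp add: quat_eq_iff mult.commute)
  qed
  show "x \<noteq> 0 \<Longrightarrow> inverse x * x = 1" "x \<noteq> 0 \<Longrightarrow> x * inverse x = 1"
    using inv by auto
  show "inverse (0 :: quat) = 0"
    by (simp add: quat_eq_iff)
  show "x div y = x * inverse y"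
    by (simp add: divide_quat_def)
  have "(norm (x * y))\<^sup>2 = (norm x * norm y)\<^sup>2"
    by (simp add: power_mult_distrib norm_sq algebra_simps)
  then show "norm (x * y) = norm x * norm y"
    by (simp add: power2_eq_iff_nonneg)
qed

end


section \<open>Points of the extended quaternionic line and the cross-ratio\<close>

datatype quat_pt = Fin quat | Infty

text \<open>
  A matrix entry in row $i$ and column $j$ is \<open>M $ i $ j\<close>. The two conventions at infinity are
  $L(q) = \infty$ when $cq + d = 0$, and $L(\infty) = a c^{-1}$ ($= \infty$ when $c = 0$).
\<close>

definition frac_lin :: "quat ^ 2 ^ 2 \<Rightarrow> quat_pt \<Rightarrow> quat_pt" where
  "frac_lin M p =
    (let a = M $ 1 $ 1; b = M $ 1 $ 2; c = M $ 2 $ 1; d = M $ 2 $ 2 in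
     case p of
       Fin q \<Rightarrow> if c * q + d = 0 then Infty else Fin ((a * q + b) * inverse (c * q + d))
     | Infty \<Rightarrow> if c = 0 then Infty else Fin (a * inverse c))"

definition is_frac_lin :: "(quat_pt \<Rightarrow> quat_pt) \<Rightarrow> bool" where
  "is_frac_lin L \<longleftrightarrow> (\<exists>M. invertible M \<and> L = frac_lin M)"

definition cross_ratio :: "quat \<Rightarrow> quat \<Rightarrow> quat \<Rightarrow> quat \<Rightarrow> quat" where
  "cross_ratio q1 q2 q3 q4 =
    (q1 - q3) * inverse (q1 - q4) * (q2 - q4) * inverse (q2 - q3)"

text \<open>
  For pairwise distinct points at most one is \<open>Infty\<close>, so the last equation is a dummy value.
\<close>

fun cross_ratio_pt :: "quat_pt \<Rightarrow> quat_pt \<Rightarrow> quat_pt \<Rightarrow> quat_pt \<Rightarrow> quat" where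
  "cross_ratio_pt (Fin q1) (Fin q2) (Fin q3) (Fin q4) = cross_ratio q1 q2 q3 q4"
| "cross_ratio_pt Infty (Fin q2) (Fin q3) (Fin q4) =
    Lim at_top (\<lambda>x::real. cross_ratio (of_real x) q2 q3 q4)"
| "cross_ratio_pt (Fin q1) Infty (Fin q3) (Fin q4) =
    Lim at_top (\<lambda>x::real. cross_ratio q1 (of_real x) q3 q4)"
| "cross_ratio_pt (Fin q1) (Fin q2) Infty (Fin q4) =
    Lim at_top (\<lambda>x::real. cross_ratio q1 q2 (of_real x) q4)"
| "cross_ratio_pt (Fin q1) (Fin q2) (Fin q3) Infty =
    Lim at_top (\<lambda>x::real. cross_ratio q1 q2 q3 (of_real x))"
| "cross_ratio_pt _ _ _ _ = undefined"

end

theory Submission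
  imports Defs
begin

text \<open>
  Extend the difference $p - q$ to the point at infinity by $\infty - q = 1$ and $p - \infty = -1$.
  The cross-ratio of distinct points, including its limits at infinity, is then always
  $(p_1 - p_3)(p_1 - p_4)^{-1}(p_2 - p_4)(p_2 - p_3)^{-1}$, so that a
  single formula covers finite and infinite points (\<open>cross_ratio_pt_eq_pt_diff\<close>).

  A fractional linear transformation distorts these differences by nonzero factors, each of which
  depends on one of the two points only: $L(p) - L(q) = \alpha(q)\,(p - q)\,\beta(p)$
  (\<open>frac_lin_pt_diff_factor\<close>). For finite points and $c \neq 0$ this comes from
  $L(q) = ac^{-1} + e\,(cq+d)^{-1}$ with $e = b - ac^{-1}d$ and from the resolvent identity
  $u^{-1} - v^{-1} = v^{-1}(v - u)u^{-1}$. It matters that the factor on the left belongs to the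
  second point, although the first point comes first in the product: all four differences in the
  cross-ratio then have matching factors between them, which cancel and leave
  $\mathcal{CR}(L(p_1),\dots,L(p_4)) = \alpha(p_3)\,\mathcal{CR}(p_1,\dots,p_4)\,\alpha(p_3)^{-1}$.
  In general the cross-ratio is thus only invariant up to conjugation, but a real number is central
  and equals all of its conjugates.
\<close>

section \<open>Differences of points on the extended quaternionic line\<close>

text \<open>
  The values at infinity are what remains of a difference after dropping the divergent real
  factor $x \to +\infty$, and $\infty - \infty = 0$ makes the difference vanish on the whole diagonal.
\<close>

fun pt_diff :: "quat_pt \<Rightarrow> quat_pt \<Rightarrow> quat" where
  "pt_diff (Fin p) (Fin q) = p - q"
| "pt_diff Infty (Fin q) = 1"
| "pt_diff (Fin p) Infty = -1"
| "pt_diff Infty Infty = 0"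

lemma pt_diff_eq_0_iff [simp]: "pt_diff p q = 0 \<longleftrightarrow> p = q"
  by (cases p; cases q) auto

section \<open>The cross-ratio at infinity\<close>

lemma filterlim_diff_of_real_at_infinity:
  fixes a :: "'a::real_normed_algebra_1"
  shows "filterlim (\<lambda>x::real. a - of_real x) at_infinity at_top"
proof -
  have "filterlim (\<lambda>x. of_real x :: 'a) at_infinity at_top"
    unfolding filterlim_at_infinity_conv_norm_at_top norm_of_real
    by (rule filterlim_at_top_imp_at_infinity filterlim_abs_real)+
  then have "filterlim (\<lambda>x. - (of_real x :: 'a)) at_infinity at_top"
    by (simp add: filterlim_at_infinity_conv_norm_at_top)
  from tendsto_add_filterlim_at_infinity[OF tendsto_const this] show ?thesis
    by simp
qed

lemma tendsto_inverse_diff_of_real: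
  fixes a :: "'a::real_normed_div_algebra"
  shows "((\<lambda>x::real. inverse (a - of_real x)) \<longlongrightarrow> 0) at_top"
  by (rule filterlim_compose[OF tendsto_inverse_0 filterlim_diff_of_real_at_infinity])

lemma eventually_diff_of_real_nonzero:
  fixes a :: "'a::real_normed_div_algebra"
  shows "eventually (\<lambda>x::real. a - of_real x \<noteq> 0) at_top"
  by (rule filterlim_at_infinity_imp_eventually_ne[OF filterlim_diff_of_real_at_infinity])

text \<open>
  A real $x$ commutes with $k$, so $(a - x)k$ and $k(b - x)$ differ by a term that does not
  depend on $x$, and that term is killed by $(b - x)^{-1} \to 0$.
\<close>

lemma tendsto_mult_inverse_diff_of_real:
  fixes a b k :: "'a::real_normed_div_algebra"
  shows "((\<lambda>x::real. (a - of_real x) * k * inverse (b - of_real x)) \<longlongrightarrow> k) at_top"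
proof -
  have "eventually (\<lambda>x::real. k + (a * k - k * b) * inverse (b - of_real x) =
      (a - of_real x) * k * inverse (b - of_real x)) at_top"
    using eventually_diff_of_real_nonzero[of b]
  proof eventually_elim
    case (elim x)
    have "k = k * (b - of_real x) * inverse (b - of_real x)"
      using elim by (simp add: mult.assoc)
    moreover have "(a - of_real x) * k = k * (b - of_real x) + (a * k - k * b)"
      by (simp add: algebra_simps Real_Vector_Spaces.of_real_def)
    ultimately show ?case
      by (metis distrib_right)
  qed
  moreover have "((\<lambda>x::real. k + (a * k - k * b) * inverse (b - of_real x)) \<longlongrightarrow>
      k + (a * k - k * b) * 0) at_top"
    by (intro tendsto_intros tendsto_inverse_diff_of_real)
  ultimately show ?thesis
    using Lim_transform_eventually by fastforce
qed

lemma tendsto_inverse_mult_diff_of_real: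
  fixes a b :: "'a::real_normed_div_algebra"
  shows "((\<lambda>x::real. inverse (a - of_real x) * (b - of_real x)) \<longlongrightarrow> 1) at_top"
proof -
  have "eventually (\<lambda>x::real. 1 + inverse (a - of_real x) * (b - a) =
      inverse (a - of_real x) * (b - of_real x)) at_top"
    using eventually_diff_of_real_nonzero[of a]
  proof eventually_elim
    case (elim x)
    have "inverse (a - of_real x) * (b - of_real x) =
        inverse (a - of_real x) * ((a - of_real x) + (b - a))"
      by simp
    also have "\<dots> = 1 + inverse (a - of_real x) * (b - a)"
      by (simp only: distrib_left left_inverse[OF elim])
    finally show ?case ..
  qed
  moreover have "((\<lambda>x::real. 1 + inverse (a - of_real x) * (b - a)) \<longlongrightarrow> 1 + 0 * (b - a)) at_top"
    by (intro tendsto_intros tendsto_inverse_diff_of_real)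
  ultimately show ?thesis
    using Lim_transform_eventually by fastforce
qed

lemma cross_ratio_pt_eq_pt_diff:
  assumes "distinct [p1, p2, p3, p4]"
  shows "cross_ratio_pt p1 p2 p3 p4 =
    pt_diff p1 p3 * inverse (pt_diff p1 p4) * pt_diff p2 p4 * inverse (pt_diff p2 p3)"
proof -
  note lim = tendsto_Lim[OF trivial_limit_at_top_linorder]
  have flip: "of_real x - q = - (q - of_real x)" for x and q :: quat
    by simp
  consider
      (fin) q1 q2 q3 q4 where "p1 = Fin q1" "p2 = Fin q2" "p3 = Fin q3" "p4 = Fin q4"
    | (inf1) q2 q3 q4 where "p1 = Infty" "p2 = Fin q2" "p3 = Fin q3" "p4 = Fin q4"
    | (inf2) q1 q3 q4 where "p1 = Fin q1" "p2 = Infty" "p3 = Fin q3" "p4 = Fin q4"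
    | (inf3) q1 q2 q4 where "p1 = Fin q1" "p2 = Fin q2" "p3 = Infty" "p4 = Fin q4"
    | (inf4) q1 q2 q3 where "p1 = Fin q1" "p2 = Fin q2" "p3 = Fin q3" "p4 = Infty"
    using assms by (cases p1; cases p2; cases p3; cases p4) auto
  then show ?thesis
  proof cases
    case fin
    then show ?thesis
      by (simp add: cross_ratio_def)
  next
    case inf1
    have "((\<lambda>x. ((q3 - of_real x) * 1 * inverse (q4 - of_real x)) *
        ((q2 - q4) * inverse (q2 - q3))) \<longlongrightarrow> 1 * ((q2 - q4) * inverse (q2 - q3))) at_top"
      by (intro tendsto_mult_right tendsto_mult_inverse_diff_of_real)
    then have "((\<lambda>x. cross_ratio (of_real x) q2 q3 q4) \<longlongrightarrow>
        (q2 - q4) * inverse (q2 - q3)) at_top"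
      by (simp add: cross_ratio_def flip mult.assoc del: minus_diff_eq)
    then show ?thesis
      using inf1 by (simp add: lim)
  next
    case inf2
    have "((\<lambda>x. ((q1 - q3) * inverse (q1 - q4)) *
        ((q4 - of_real x) * 1 * inverse (q3 - of_real x))) \<longlongrightarrow>
        ((q1 - q3) * inverse (q1 - q4)) * 1) at_top"
      by (intro tendsto_mult_left tendsto_mult_inverse_diff_of_real)
    then have "((\<lambda>x. cross_ratio q1 (of_real x) q3 q4) \<longlongrightarrow>
        (q1 - q3) * inverse (q1 - q4)) at_top"
      by (simp add: cross_ratio_def flip mult.assoc del: minus_diff_eq)
    then show ?thesis
      using inf2 by (simp add: lim)
  next
    case inf3
    have "((\<lambda>x. cross_ratio q1 q2 (of_real x) q4) \<longlongrightarrow>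
        inverse (q1 - q4) * (q2 - q4)) at_top"
      using tendsto_mult_inverse_diff_of_real[of q1 "inverse (q1 - q4) * (q2 - q4)" q2]
      by (simp add: cross_ratio_def mult.assoc)
    then show ?thesis
      using inf3 by (simp add: lim)
  next
    case inf4
    have "((\<lambda>x. (q1 - q3) * (inverse (q1 - of_real x) * (q2 - of_real x)) *
        inverse (q2 - q3)) \<longlongrightarrow> (q1 - q3) * 1 * inverse (q2 - q3)) at_top"
      by (intro tendsto_mult_right tendsto_mult_left tendsto_inverse_mult_diff_of_real)
    then have "((\<lambda>x. cross_ratio q1 q2 q3 (of_real x)) \<longlongrightarrow>
        (q1 - q3) * inverse (q2 - q3)) at_top"
      by (simp add: cross_ratio_def mult.assoc)
    then show ?thesis
      using inf4 by (simp add: lim)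
  qed
qed

section \<open>Distortion of differences by a fractional linear transformation\<close>

lemma invertible_matrix_vector_mult_eq_0:
  fixes M :: "'a::semiring_1 ^ 'n ^ 'n"
  assumes "invertible M" "M *v v = 0"
  shows "v = 0"
proof -
  obtain N where "N ** M = mat 1"
    using assms(1) by (auto simp: invertible_def)
  then have "v = N *v (M *v v)"
    by (simp add: matrix_vector_mul_assoc)
  then show ?thesis
    using assms(2) by simp
qed

lemma invertible_2_kernel:
  fixes M :: "'a::semiring_1 ^ 2 ^ 2"
  assumes "invertible M" "M $ 1 $ 1 * x + M $ 1 $ 2 * y = 0" "M $ 2 $ 1 * x + M $ 2 $ 2 * y = 0"
  shows "x = 0 \<and> y = 0"
proof -
  have "M *v vector [x, y] = 0"
    using assms(2,3) by (simp add: vec_eq_iff forall_2 matrix_vector_mult_def sum_2)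
  with assms(1) have "vector [x, y] = (0 :: 'a ^ 2)"
    by (rule invertible_matrix_vector_mult_eq_0)
  then show ?thesis
    by (simp add: vec_eq_iff forall_2)
qed

text \<open>
  Over a skew field, $b - ac^{-1}d$ takes over the role of the determinant when $c \neq 0$.
\<close>

lemma invertible_2_schur_complement:
  fixes M :: "'a::division_ring ^ 2 ^ 2"
  assumes "invertible M" "M $ 2 $ 1 \<noteq> 0"
  shows "M $ 1 $ 2 - M $ 1 $ 1 * inverse (M $ 2 $ 1) * M $ 2 $ 2 \<noteq> 0"
proof
  assume "M $ 1 $ 2 - M $ 1 $ 1 * inverse (M $ 2 $ 1) * M $ 2 $ 2 = 0"
  with assms(2) have "inverse (M $ 2 $ 1) * M $ 2 $ 2 = 0 \<and> (-1 :: 'a) = 0"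
    by (intro invertible_2_kernel[OF assms(1)]) (simp_all flip: mult.assoc)
  then show False
    by simp
qed

lemma invertible_2_upper_triangular:
  fixes M :: "'a::division_ring ^ 2 ^ 2"
  assumes "invertible M" "M $ 2 $ 1 = 0"
  shows "M $ 1 $ 1 \<noteq> 0" "M $ 2 $ 2 \<noteq> 0"
proof -
  show a: "M $ 1 $ 1 \<noteq> 0"
    using invertible_2_kernel[OF assms(1), of 1 0] assms(2) by auto
  show "M $ 2 $ 2 \<noteq> 0"
    using invertible_2_kernel[OF assms(1), of "- inverse (M $ 1 $ 1) * M $ 1 $ 2" 1] assms(2) a
    by (auto simp flip: mult.assoc)
qed

lemma inverse_diff_inverse_swapped:
  fixes u v :: "'a::division_ring"
  assumes "u \<noteq> 0" "v \<noteq> 0"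
  shows "inverse u - inverse v = inverse v * (v - u) * inverse u"
  using assms by (simp add: algebra_simps)

text \<open>
  For $c \neq 0$ and finite points away from the pole, the resolvent identity gives the factors
  $\alpha(q) = e\,(cq+d)^{-1}c$ and $\beta(p) = -(cp+d)^{-1}$. Their values at the pole and at
  infinity are then forced by the identity with the other point finite; the same reasoning
  applies to $\alpha = a$, $\beta = d^{-1}$ in the affine case $c = 0$.
\<close>

lemma frac_lin_pt_diff_factor:
  assumes "invertible M"
  obtains \<alpha> \<beta> where "\<And>q. \<alpha> q \<noteq> 0" "\<And>p. \<beta> p \<noteq> 0"
    "\<And>p q. p \<noteq> q \<Longrightarrow> pt_diff (frac_lin M p) (frac_lin M q) = \<alpha> q * pt_diff p q * \<beta> p"
proof -
  define a b c d where abcd: "a = M $ 1 $ 1" "b = M $ 1 $ 2" "c = M $ 2 $ 1" "d = M $ 2 $ 2"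
  have L_Fin: "frac_lin M (Fin q) =
      (if c * q + d = 0 then Infty else Fin ((a * q + b) * inverse (c * q + d)))" for q
    by (simp add: frac_lin_def Let_def abcd)
  have L_Infty: "frac_lin M Infty = (if c = 0 then Infty else Fin (a * inverse c))"
    by (simp add: frac_lin_def Let_def abcd)
  show thesis
  proof (cases "c = 0")
    case True
    have nz: "a \<noteq> 0" "d \<noteq> 0"
      using invertible_2_upper_triangular[OF assms] True by (simp_all add: abcd)
    show thesis
    proof (rule that)
      let ?\<alpha> = "case_quat_pt (\<lambda>q. a) d"
      let ?\<beta> = "case_quat_pt (\<lambda>p. inverse d) (inverse a)"
      show "?\<alpha> q \<noteq> 0" "?\<beta> q \<noteq> 0" for q
        using nz by (auto split: quat_pt.split)
      show "pt_diff (frac_lin M p) (frac_lin M q) = ?\<alpha> q * pt_diff p q * ?\<beta> p"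
        if "p \<noteq> q" for p q
        using that nz True
        by (cases p; cases q) (simp_all add: L_Fin L_Infty algebra_simps)
    qed
  next
    case False
    define e where "e = b - a * inverse c * d"
    have e: "e \<noteq> 0"
      using invertible_2_schur_complement[OF assms] False by (simp add: abcd e_def)
    have L_finite: "frac_lin M (Fin q) = Fin (a * inverse c + e * inverse (c * q + d))"
      if "c * q + d \<noteq> 0" for q
    proof -
      have "a * q + b = a * inverse c * (c * q + d) + e"
        using False by (simp add: e_def distrib_left mult.assoc flip: mult.assoc[of "inverse c" c])
      then have "(a * q + b) * inverse (c * q + d) =
          a * inverse c * ((c * q + d) * inverse (c * q + d)) + e * inverse (c * q + d)"
        by (simp only: distrib_right mult.assoc)
      then show ?thesis
        using that by (simp add: L_Fin)
    qed
    have L_pole: "frac_lin M (Fin q) = Infty" if "c * q + d = 0" for q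
      using that by (simp add: L_Fin)
    have L_at_Infty: "frac_lin M Infty = Fin (a * inverse c)"
      using False by (simp add: L_Infty)
    \<comment> \<open>If \<open>q\<close> is the pole, then \<open>c * p + d = c * (p - q)\<close>.\<close>
    have denom_diff: "c * (p - q) = (c * p + d) - (c * q + d)" for p q
      by (simp add: algebra_simps)
    let ?\<alpha> = "case_quat_pt (\<lambda>q. if c * q + d = 0 then c else e * inverse (c * q + d) * c) e"
    let ?\<beta> = "case_quat_pt
      (\<lambda>p. if c * p + d = 0 then - inverse e else - inverse (c * p + d)) (- inverse c)"
    have main: "pt_diff (frac_lin M (Fin p)) (frac_lin M (Fin q)) =
        ?\<alpha> (Fin q) * (p - q) * ?\<beta> (Fin p)" if "p \<noteq> q" for p q
    proof -
      let ?u = "c * p + d" and ?v = "c * q + d"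
      have ne: "p - q \<noteq> 0"
        using that by simp
      have "\<not> (?u = 0 \<and> ?v = 0)"
        using denom_diff[of p q] ne False by (metis diff_zero mult_eq_0_iff)
      then consider (generic) "?u \<noteq> 0" "?v \<noteq> 0" | (pole1) "?u = 0" "?v \<noteq> 0" | (pole2) "?u \<noteq> 0" "?v = 0"
        by blast
      then show ?thesis
      proof cases
        case generic
        have "e * inverse ?u - e * inverse ?v = e * (inverse ?v * (?v - ?u) * inverse ?u)"
          by (simp only: inverse_diff_inverse_swapped[OF generic] flip: right_diff_distrib)
        also have "?v - ?u = - (c * (p - q))"
          by (simp only: denom_diff minus_diff_eq)
        finally show ?thesis
          using generic by (simp add: L_finite mult.assoc)
      next
        case pole1
        have "c * (p - q) = - ?v"
          by (simp only: denom_diff pole1 diff_0)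
        moreover have "e * inverse ?v * c * (p - q) = e * inverse ?v * (c * (p - q))"
          by (simp only: mult.assoc)
        ultimately have "e * inverse ?v * c * (p - q) = - (e * (inverse ?v * ?v))"
          by (simp only: mult_minus_right mult.assoc)
        then show ?thesis
          using pole1 e by (simp add: L_finite L_pole)
      next
        case pole2
        have "c * (p - q) = ?u"
          using denom_diff[of p q] pole2 by simp
        then show ?thesis
          using pole2 by (simp add: L_finite L_pole)
      qed
    qed
    show thesis
    proof (rule that)
      show "?\<alpha> q \<noteq> 0" "?\<beta> q \<noteq> 0" for q
        using False e by (auto split: quat_pt.split)
      show "pt_diff (frac_lin M p) (frac_lin M q) = ?\<alpha> q * pt_diff p q * ?\<beta> p"
        if "p \<noteq> q" for p q
      proof (cases p; cases q)
        fix x y assume "p = Fin x" "q = Fin y"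
        then show ?thesis
          using main[of x y] that by simp
      next
        fix x assume "p = Fin x" "q = Infty"
        then show ?thesis
          using e by (cases "c * x + d = 0") (simp_all add: L_finite L_pole L_at_Infty)
      next
        fix y assume "p = Infty" "q = Fin y"
        then show ?thesis
          using False
          by (cases "c * y + d = 0") (simp_all add: L_finite L_pole L_at_Infty mult.assoc)
      qed (use that in simp)
    qed
  qed
qed

section \<open>Invariance of real cross-ratios\<close>

text \<open>
  The factors at $p_1$, $p_4$ and $p_2$ cancel in this order, and only the one at $p_3$ survives,
  on both ends of the product.
\<close>

lemma cross_ratio_pt_frac_lin_conjugate:
  assumes "distinct [p1, p2, p3, p4]" "invertible M"
  obtains g where "g \<noteq> 0"
    "cross_ratio_pt (frac_lin M p1) (frac_lin M p2) (frac_lin M p3) (frac_lin M p4) =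
      g * cross_ratio_pt p1 p2 p3 p4 * inverse g"
proof -
  obtain \<alpha> \<beta> where nz: "\<And>q. \<alpha> q \<noteq> 0" "\<And>p. \<beta> p \<noteq> 0"
    and diff: "\<And>p q. p \<noteq> q \<Longrightarrow>
      pt_diff (frac_lin M p) (frac_lin M q) = \<alpha> q * pt_diff p q * \<beta> p"
    using frac_lin_pt_diff_factor[OF assms(2)] by metis
  have "frac_lin M p \<noteq> frac_lin M q" if "p \<noteq> q" for p q
    using diff[OF that] nz that by (metis mult_eq_0_iff pt_diff_eq_0_iff)
  with assms(1) have
    "distinct [frac_lin M p1, frac_lin M p2, frac_lin M p3, frac_lin M p4]"
    by simp
  note cr_image = cross_ratio_pt_eq_pt_diff[OF this]
  have cancel: "x * (inverse x * y) = y" "inverse x * (x * y) = y" if "x \<noteq> 0" for x y :: quat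
    using that by (simp_all flip: mult.assoc)
  have "cross_ratio_pt (frac_lin M p1) (frac_lin M p2) (frac_lin M p3) (frac_lin M p4) =
      \<alpha> p3 * cross_ratio_pt p1 p2 p3 p4 * inverse (\<alpha> p3)"
    unfolding cr_image cross_ratio_pt_eq_pt_diff[OF assms(1)]
    using assms(1) nz by (simp add: diff nonzero_inverse_mult_distrib mult.assoc cancel)
  with nz that show thesis
    by blast
qed

theorem proposition1p3:
  fixes p1 p2 p3 p4 :: quat_pt and L :: "quat_pt \<Rightarrow> quat_pt"
  assumes "distinct [p1, p2, p3, p4]"
    and "cross_ratio_pt p1 p2 p3 p4 \<in> \<real>"
    and "is_frac_lin L"
  shows "cross_ratio_pt (L p1) (L p2) (L p3) (L p4) = cross_ratio_pt p1 p2 p3 p4"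
proof -
  obtain M where M: "invertible M" "L = frac_lin M"
    using assms(3) by (auto simp: is_frac_lin_def)
  obtain g where g: "g \<noteq> 0" "cross_ratio_pt (L p1) (L p2) (L p3) (L p4) =
      g * cross_ratio_pt p1 p2 p3 p4 * inverse g"
    using cross_ratio_pt_frac_lin_conjugate[OF assms(1) M(1)] M(2) by metis
  obtain r where "cross_ratio_pt p1 p2 p3 p4 = of_real r"
    using assms(2) by (rule Reals_cases)
  with g show ?thesis
    by (simp add: Real_Vector_Spaces.of_real_def)
qed

end
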